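(* Let $q>2$ be a prime power and $n=q^2$. Let $t$ be an integer with $1\le t\le\lceil\frac{n}{2q}\rceil$, and let the integers $k,l$ satisfy one of: - $(t-1)q+1\le k\le tq-t$ and $l=k-(t-1)^2$; - $k=tq-t+1$ and $l=k-(t-1)^2-1$; - $tq-t+2\le k\le tq$ and $l=2tq-t^2-k$. Then for each integer $0\le s\le l$ there exists an $[n,k]_{q^2}$ MDS code with $s$-dimensional Hermitian hull.
   Context: For a linear code $\mathcal C\subseteq\mathbb F_{q^2}^n$, $\mathcal C^{\perp_H}=\{\bm x:\sum_i y_ix_i^q=0\ \text{for all }\bm y\in\mathcal C\}$, and the Hermitian hull is $\mathrm{Hull}_H(\mathcal C)=\mathcal C\cap\mathcal C^{\perp_H}$. An $[n,k]_{q^2}$ code is a $k$-dimensional subspace of $\mathbb F_{q^2}^n$; it is MDS if its minimum distance is $n-k+1$. *)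

theory Defs
  imports "HOL-Analysis.Cartesian_Space" "HOL-Number_Theory.Prime_Powers"
begin

text \<open>
  A field with $q^2$ elements is a type \<open>'a :: {field, finite}\<close> with \<open>CARD('a) = q\<^sup>2\<close>, and
  length-\<open>n\<close> words over it are elements of \<open>'a ^ 'n\<close> with \<open>CARD('n) = n\<close>. Subspaces and dimensions
  are taken with respect to componentwise scalar multiplication \<open>*s\<close>.
\<close>

definition is_code :: "nat \<Rightarrow> ('a :: field ^ 'n) set \<Rightarrow> bool" where
  "is_code k C \<longleftrightarrow> vec.subspace C \<and> vec.dim C = k"

definition hamming_dist :: "'a ^ 'n \<Rightarrow> 'a ^ 'n \<Rightarrow> nat" where
  "hamming_dist x y = card {i. x $ i \<noteq> y $ i}"

text \<open>For codes with at most one word this is the unspecified minimum of the empty set.\<close>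

definition min_distance :: "('a ^ 'n) set \<Rightarrow> nat" where
  "min_distance C = Min {hamming_dist x y | x y. x \<in> C \<and> y \<in> C \<and> x \<noteq> y}"

text \<open>The subtraction does not truncate, since a code of length \<open>n\<close> has dimension at most \<open>n\<close>.\<close>

definition is_MDS :: "nat \<Rightarrow> ('a :: field ^ 'n) set \<Rightarrow> bool" where
  "is_MDS k C \<longleftrightarrow> is_code k C \<and> min_distance C = CARD('n) - k + 1"

text \<open>The parameter \<open>q\<close> is the square root of the field size.\<close>

definition hermitian_dual :: "nat \<Rightarrow> ('a :: field ^ 'n) set \<Rightarrow> ('a ^ 'n) set" where
  "hermitian_dual q C = {x. \<forall>y\<in>C. (\<Sum>i\<in>UNIV. y $ i * (x $ i) ^ q) = 0}"

definition hermitian_hull :: "nat \<Rightarrow> ('a :: field ^ 'n) set \<Rightarrow> ('a ^ 'n) set" where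
  "hermitian_hull q C = C \<inter> hermitian_dual q C"

end

theory Submission
  imports Defs "HOL-Computational_Algebra.Polynomial"
begin

text \<open>
  Take the Reed--Solomon code of all polynomials of degree below \<open>k\<close>, evaluated at every point of
  the field. Power sums over the field vanish unless the exponent is a positive multiple of
  \<open>q\<^sup>2 - 1\<close>, so in the monomial basis the Hermitian Gram matrix is a partial permutation matrix:
  monomials \<open>i\<close> and \<open>j\<close> pair nontrivially iff the base-\<open>q\<close> digits of \<open>j\<close> are the complemented and
  swapped digits of \<open>i\<close>. The hull is spanned by the monomials whose partner has degree at least
  \<open>k\<close>, and counting them gives dimension \<open>l\<close>. Scaling one coordinate by \<open>a\<close> with
  \<open>a ^ (q + 1) \<noteq> 1\<close>, which exists because \<open>q > 2\<close>, lowers the hull dimension by one and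
  preserves all distances; repeating this reaches every \<open>s \<le> l\<close>.
\<close>

section \<open>Powers and power sums in a finite field\<close>

text \<open>Multiplication by \<open>x\<close> permutes the nonzero elements, so their product is
  unchanged by the factor \<open>x\<close> on each of them.\<close>

lemma finite_field_power_card_minus_1:
  fixes x :: "'a :: {field, finite}"
  assumes "x \<noteq> 0"
  shows "x ^ (CARD('a) - 1) = 1"
proof -
  have "(\<Prod>y\<in>UNIV-{0}. x * y) = (\<Prod>y\<in>UNIV-{0}. y)"
    by (rule prod.reindex_bij_witness[of _ "\<lambda>y. y / x" "\<lambda>y. x * y"]) (use assms in auto)
  moreover have "(\<Prod>y\<in>UNIV-{0}. x * y) = x ^ (CARD('a) - 1) * (\<Prod>y\<in>UNIV-{0}. y)"
    by (simp add: prod.distrib card_Diff_singleton)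
  moreover have "(\<Prod>y\<in>UNIV-{0::'a}. y) \<noteq> 0"
    by simp
  ultimately show ?thesis
    by simp
qed

text \<open>Translation by 1 permutes the field, so adding 1 to every element does not change the
  sum of all elements.\<close>

lemma finite_field_of_nat_card: "of_nat CARD('a) = (0 :: 'a :: {field, finite})"
proof -
  have "(\<Sum>x\<in>UNIV. x + 1) = (\<Sum>x\<in>UNIV. x :: 'a)"
    by (rule sum.reindex_bij_witness[of _ "\<lambda>x. x - 1" "\<lambda>x. x + 1"]) auto
  then show ?thesis
    by (simp add: sum.distrib)
qed

text \<open>The characteristic divides \<open>q ^ 2\<close>, hence \<open>q\<close> is a power of it
  and raising to the power \<open>q\<close> is an iterated Frobenius map.\<close>

lemma finite_field_power_sum:
  fixes f :: "'b \<Rightarrow> 'a :: {field, finite}"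
  assumes "primepow q" and "CARD('a) = q\<^sup>2"
  shows "(\<Sum>x\<in>A. f x) ^ q = (\<Sum>x\<in>A. f x ^ q)"
proof -
  obtain p m where p: "prime p" "m > 0" "q = p ^ m"
    using assms(1) by (auto simp: primepow_def)
  have "CHAR('a) dvd p ^ (m * 2)"
    using finite_field_of_nat_card[where 'a = 'a] assms(2) p
    by (simp add: of_nat_eq_0_iff_char_dvd power_mult del: of_nat_power)
  moreover have C: "prime CHAR('a)"
    by (intro prime_CHAR_semidom finite_imp_CHAR_pos) simp
  ultimately have "CHAR('a) = p"
    using p(1) by (metis prime_dvd_power primes_dvd_imp_eq)
  then show ?thesis
    using freshmans_dream_sum'[OF C, of q m f A] p(3) by simp
qed

text \<open>The polynomial \<open>X ^ r - 1\<close> has at most \<open>r\<close> roots, too few to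
  cover all nonzero elements.\<close>

lemma finite_field_ex_power_neq_1:
  assumes "0 < r" and "r < CARD('a :: {field, finite}) - 1"
  shows "\<exists>a::'a. a \<noteq> 0 \<and> a ^ r \<noteq> 1"
proof (rule ccontr)
  assume H: "\<not> ?thesis"
  let ?p = "monom (1::'a) r - 1"
  have "coeff ?p r = 1"
    using assms by (simp add: coeff_1)
  then have "?p \<noteq> 0"
    by (metis coeff_0 zero_neq_one)
  then have "card {x. poly ?p x = 0} \<le> degree ?p"
    by (rule card_poly_roots_bound)
  also have "\<dots> \<le> r"
    by (intro degree_diff_le) (auto simp: degree_monom_le)
  finally have "card {x. poly ?p x = 0} \<le> r" .
  moreover have "card (UNIV - {0::'a}) \<le> card {x. poly ?p x = 0}"
    using H by (intro card_mono) (auto simp: poly_monom)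
  ultimately show False
    using assms by (simp add: card_Diff_singleton)
qed

text \<open>For a positive multiple of the group order every nonzero summand is 1 and the sum is -1.
  For any other positive exponent, substituting \<open>a * x\<close> multiplies the sum by
  \<open>a ^ m\<close>, and some \<open>a\<close> has \<open>a ^ m \<noteq> 1\<close>.\<close>

lemma finite_field_sum_power:
  "(\<Sum>x\<in>UNIV. (x :: 'a :: {field, finite}) ^ m) = 0 \<longleftrightarrow> \<not> (0 < m \<and> (CARD('a) - 1) dvd m)"
proof (cases "m = 0")
  case True
  \<comment> \<open>Since \<open>0 ^ 0 = 1\<close>, exponent 0 counts the whole field, and this
    count is 0 in the field.\<close>
  then show ?thesis
    using finite_field_of_nat_card by simp
next
  case m: False
  show ?thesis
  proof (cases "(CARD('a) - 1) dvd m")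
    case True
    then obtain c where c: "m = (CARD('a) - 1) * c" ..
    have "x ^ m = (if x = 0 then 0 else 1)" for x :: 'a
      using m by (simp add: c power_mult finite_field_power_card_minus_1 del: One_nat_def)
    then have "(\<Sum>x\<in>UNIV. (x :: 'a) ^ m) = of_nat (CARD('a) - 1)"
      by (simp add: sum.If_cases Compl_eq_Diff_UNIV card_Diff_singleton flip: Diff_eq)
    also have "\<dots> = -1"
      using finite_field_of_nat_card[where 'a = 'a] by (simp add: of_nat_diff)
    finally show ?thesis
      using m True by simp
  next
    case False
    define r where "r = m mod (CARD('a) - 1)"
    have "CARD('a) \<ge> 2"
      using card_mono[of UNIV "{0, 1::'a}"] by simp
    then have "0 < r" "r < CARD('a) - 1"
      using False by (auto simp: r_def mod_greater_zero_iff_not_dvd)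
    then obtain a :: 'a where a: "a \<noteq> 0" "a ^ r \<noteq> 1"
      using finite_field_ex_power_neq_1 by blast
    have "a ^ m = a ^ (r + (CARD('a) - 1) * (m div (CARD('a) - 1)))"
      unfolding r_def by simp
    also have "\<dots> = a ^ r"
      using a by (simp add: power_add power_mult finite_field_power_card_minus_1 del: One_nat_def)
    finally have am: "a ^ m \<noteq> 1"
      using a by simp
    have "(\<Sum>x\<in>UNIV. (a * x) ^ m) = (\<Sum>x\<in>UNIV. (x :: 'a) ^ m)"
      by (rule sum.reindex_bij_witness[of _ "\<lambda>y. y / a" "\<lambda>y. a * y"]) (use a in auto)
    then have "a ^ m * (\<Sum>x\<in>UNIV. (x :: 'a) ^ m) = (\<Sum>x\<in>UNIV. (x :: 'a) ^ m)"
      by (simp add: power_mult_distrib sum_distrib_left)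
    then show ?thesis
      using am False by simp
  qed
qed

lemma finite_field_power_card_mult:
  fixes x :: "'a :: {field, finite}"
  shows "x ^ (CARD('a) * m) = x ^ m"
proof -
  have "x ^ CARD('a) = x"
    using finite_field_power_card_minus_1[of x] by (cases "x = 0") (simp_all flip: power_Suc add: power_eq_if)
  then show ?thesis
    by (simp add: power_mult)
qed

text \<open>
  Since \<open>a ^ q\<^sup>2 = a\<close>, the exponent \<open>j + q * i\<close> may be replaced by
  \<open>(i div q + j mod q) + q * (i mod q + j div q)\<close>, which in the range considered is a positive
  multiple of \<open>q\<^sup>2 - 1\<close> only if both brackets equal \<open>q - 1\<close>.
\<close>

lemma sum_monomials_hermitian:
  assumes card: "CARD('a :: {field, finite}) = q\<^sup>2" and "2 < q" and "2 * t \<le> q + 1"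
    and "i < t * q" and "j < t * q"
  shows "(\<Sum>a\<in>UNIV. (a::'a) ^ j * (a ^ i) ^ q) \<noteq> 0 \<longleftrightarrow>
         i mod q + j div q = q - 1 \<and> i div q + j mod q = q - 1"
proof -
  define i0 i1 j0 j1 where ij: "i0 = i mod q" "i1 = i div q" "j0 = j mod q" "j1 = j div q"
  define e where "e = (i1 + j0) + q * (i0 + j1)"
  have i: "i = i0 + q * i1" and j: "j = j0 + q * j1"
    by (simp_all add: ij)
  have le: "i1 < t" "j1 < t" "i0 < q" "j0 < q"
    using assms by (auto simp: ij less_mult_imp_div_less)
  have "a ^ j * (a ^ i) ^ q = a ^ e" for a :: 'a
  proof -
    have "a ^ j * (a ^ i) ^ q = a ^ (j0 + q * j1 + q * i0) * a ^ (CARD('a) * i1)"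
      by (simp add: i j card power2_eq_square algebra_simps flip: power_mult power_add)
    also have "\<dots> = a ^ (j0 + q * j1 + q * i0) * a ^ i1"
      by (simp only: finite_field_power_card_mult)
    also have "\<dots> = a ^ e"
      by (simp add: e_def algebra_simps flip: power_add)
    finally show ?thesis .
  qed
  then have "(\<Sum>a\<in>UNIV. (a::'a) ^ j * (a ^ i) ^ q) \<noteq> 0 \<longleftrightarrow> 0 < e \<and> (q\<^sup>2 - 1) dvd e"
    by (simp add: finite_field_sum_power card)
  also have "\<dots> \<longleftrightarrow> i0 + j1 = q - 1 \<and> i1 + j0 = q - 1"
  proof
    assume "i0 + j1 = q - 1 \<and> i1 + j0 = q - 1"
    then have "e = q\<^sup>2 - 1"
      using assms(2) by (simp add: e_def power2_eq_square algebra_simps)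
    moreover have "0 < q\<^sup>2 - 1"
      using assms(2) one_less_power[of q 2] by simp
    ultimately show "0 < e \<and> (q\<^sup>2 - 1) dvd e"
      by simp
  next
    assume H: "0 < e \<and> (q\<^sup>2 - 1) dvd e"
    then obtain c where c: "e = (q\<^sup>2 - 1) * c" by auto
    \<comment> \<open>The bound on \<open>t\<close> keeps each bracket at most
      \<open>3 * (q - 1) / 2\<close>, which is at most \<open>b\<close> because
      \<open>q > 2\<close>. This makes \<open>e\<close> less than twice
      \<open>q\<^sup>2 - 1\<close>, so \<open>c = 1\<close>.\<close>
    define b where "b = 2 * q - 3"
    have bound: "i1 + j0 \<le> b" "i0 + j1 \<le> b" and b: "b < (q - 1) * 2"
      using le assms(2,3) unfolding b_def by linarith+
    have q2: "q\<^sup>2 - 1 = (q - 1) * (q + 1)"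
      by (simp add: power2_eq_square algebra_simps)
    have "e \<le> b * (q + 1)"
      using add_mono[OF bound(1) mult_le_mono2[OF bound(2), of q]] unfolding e_def by (simp add: algebra_simps)
    also have "\<dots> < (q - 1) * 2 * (q + 1)"
      using b by (intro mult_strict_right_mono) auto
    finally have "(q\<^sup>2 - 1) * c < (q\<^sup>2 - 1) * 2"
      unfolding c q2 by (simp only: mult_ac)
    then have "c < 2" by simp
    moreover have "c \<noteq> 0" using H c by (metis mult_0_right less_irrefl)
    ultimately have "c = 1" by linarith
    then have e: "e = (q - 1) + q * (q - 1)"
      using c assms(2) by (simp add: power2_eq_square algebra_simps)
    then have "(i1 + j0) mod q = q - 1"
      unfolding e_def by (metis mod_mult_self2 mod_less assms(2) diff_less less_numeral_extra(1) less_trans zero_less_numeral)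
    \<comment> \<open>The next number congruent to \<open>q - 1\<close> modulo \<open>q\<close> is
      \<open>2 * q - 1\<close>, so the residue determines the bracket.\<close>
    moreover have "i1 + j0 < 2 * q - 1"
      using bound(1) b by linarith
    ultimately have "i1 + j0 = q - 1"
      by (cases "i1 + j0 < q") (auto simp: le_mod_geq not_less)
    then show "i0 + j1 = q - 1 \<and> i1 + j0 = q - 1"
      using e assms(2) unfolding e_def by (metis add_left_cancel mult_left_cancel not_less_zero)
  qed
  finally show ?thesis
    by (simp add: ij)
qed


section \<open>The Hermitian hull and lowering its dimension\<close>

text \<open>The form is semilinear in its second argument: the power \<open>q\<close> is additive,
  and a scalar \<open>c\<close> comes out as \<open>c ^ q\<close>.\<close>

lemma subspace_hermitian_hull:
  fixes C :: "('a :: {field, finite} ^ 'n) set"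
  assumes "primepow q" and "CARD('a) = q\<^sup>2" and C: "vec.subspace C"
  shows "vec.subspace (hermitian_hull q C)"
proof -
  have pow: "(a + b) ^ q = a ^ q + b ^ q" for a b :: 'a
    using finite_field_power_sum[OF assms(1,2), of "\<lambda>x. if x then a else b" UNIV]
    by (simp add: UNIV_bool add.commute)
  have "q \<noteq> 0"
    using primepow_gt_Suc_0[OF assms(1)] by simp
  moreover have "(\<Sum>i\<in>UNIV. y $ i * (c *s x) $ i ^ q) = c ^ q * (\<Sum>i\<in>UNIV. y $ i * x $ i ^ q)"
    for c and x y :: "'a ^ 'n"
    by (simp add: power_mult_distrib sum_distrib_left mult.left_commute)
  ultimately show ?thesis
    using C unfolding hermitian_hull_def hermitian_dual_def vec.subspace_def
    by (auto simp: pow distrib_left sum.distrib power_0_left simp del: vector_smult_component)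
qed

text \<open>Because \<open>a ^ (q * q) = a\<close>, exchanging the arguments of the form raises its
  value to the power \<open>q\<close>, so orthogonality is symmetric.\<close>

lemma hermitian_hull_sym:
  fixes C :: "('a :: {field, finite} ^ 'n) set"
  assumes "primepow q" and "CARD('a) = q\<^sup>2" and x: "x \<in> hermitian_hull q C" and y: "y \<in> C"
  shows "(\<Sum>i\<in>UNIV. x $ i * (y $ i) ^ q) = 0"
proof -
  have "q \<noteq> 0"
    using primepow_gt_Suc_0[OF assms(1)] by simp
  have "(a ^ q) ^ q = a" for a :: 'a
    using finite_field_power_card_mult[of a 1] assms(2)
    by (simp add: power2_eq_square flip: power_mult)
  then have "(\<Sum>i\<in>UNIV. x $ i * (y $ i) ^ q) = (\<Sum>i\<in>UNIV. (y $ i * (x $ i) ^ q) ^ q)"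
    by (simp add: power_mult_distrib mult.commute)
  also have "\<dots> = (\<Sum>i\<in>UNIV. y $ i * (x $ i) ^ q) ^ q"
    by (simp add: finite_field_power_sum[OF assms(1,2)])
  also have "\<dots> = 0"
    using x y \<open>q \<noteq> 0\<close> by (simp add: hermitian_hull_def hermitian_dual_def)
  finally show ?thesis .
qed

text \<open>Subtracting a multiple of \<open>h\<close> clears coordinate \<open>i\<close> of any
  word of \<open>H\<close>, so \<open>h\<close> together with the section spans \<open>H\<close>,
  while \<open>h\<close> lies outside the section.\<close>

lemma dim_hyperplane_section:
  fixes H :: "('a :: field ^ 'n) set"
  assumes H: "vec.subspace H" and h: "h \<in> H" "h $ i \<noteq> 0"
  shows "vec.dim H = Suc (vec.dim {x \<in> H. x $ i = 0})"
proof -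
  let ?K = "{x \<in> H. x $ i = 0}"
  have K: "vec.subspace ?K"
    using H by (auto simp: vec.subspace_def)
  have "H \<subseteq> vec.span (insert h ?K)"
  proof
    fix x assume x: "x \<in> H"
    have "x - (x $ i / h $ i) *s h \<in> vec.span ?K"
      using x h H by (intro vec.span_base) (simp add: vec.subspace_diff vec.subspace_scale)
    then show "x \<in> vec.span (insert h ?K)"
      unfolding vec.span_insert by (intro CollectI exI)
  qed
  moreover have "vec.span (insert h ?K) \<subseteq> H"
    using h by (intro vec.span_minimal H) auto
  ultimately have "vec.span (insert h ?K) = H"
    by (rule subset_antisym[rotated])
  then have "vec.dim H = vec.dim (insert h ?K)"
    by (metis vec.dim_span)
  moreover have "h \<notin> vec.span ?K"
    using h K by (simp add: vec.span_eq_iff[THEN iffD2])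
  ultimately show ?thesis
    by (simp add: vec.dim_insert)
qed

text \<open>
  Multiplying coordinate \<open>i\<close> by \<open>a\<close> adds \<open>(a ^ (q + 1) - 1) * (y $ i * (x $ i) ^ q)\<close> to the Hermitian form. Testing
  against a hull word that does not vanish at \<open>i\<close> shows that the new hull consists of the old
  hull words that vanish at \<open>i\<close>.
\<close>

lemma hermitian_hull_reduce:
  fixes C :: "('a :: {field, finite} ^ 'n) set"
  assumes q: "primepow q" "q > 2" "CARD('a) = q\<^sup>2"
    and MDS: "is_MDS k C" and hull: "is_code (Suc h) (hermitian_hull q C)"
  shows "\<exists>C' :: ('a ^ 'n) set. is_MDS k C' \<and> is_code h (hermitian_hull q C')"
proof -
  have C: "vec.subspace C" "vec.dim C = k"
    using MDS by (auto simp: is_MDS_def is_code_def)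
  obtain w i where w: "w \<in> hermitian_hull q C" "w $ i \<noteq> 0"
  proof (rule ccontr)
    assume "\<not> thesis"
    then have "x $ i = 0" if "x \<in> hermitian_hull q C" for x i
      using that \<open>\<And>i w. w \<in> hermitian_hull q C \<Longrightarrow> w $ i \<noteq> 0 \<Longrightarrow> thesis\<close> by blast
    then have "hermitian_hull q C \<subseteq> {0}"
      by (auto simp: vec_eq_iff)
    then show False
      using hull by (simp add: is_code_def flip: vec.dim_eq_0)
  qed
  \<comment> \<open>For \<open>q = 2\<close> the two sides would be equal and every nonzero
    \<open>a\<close> would satisfy \<open>a ^ (q + 1) = 1\<close>.\<close>
  have "q + 1 < CARD('a) - 1"
  proof -
    have "3 * q \<le> q * q"
      using q(2) by simp
    then show ?thesis
      using q(2) unfolding q(3) power2_eq_square by linarith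
  qed
  then obtain a :: 'a where a: "a \<noteq> 0" "a ^ (q + 1) \<noteq> 1"
    using finite_field_ex_power_neq_1[of "q + 1"] by auto
  define d where "d x = (\<chi> j. if j = i then a * x $ j else x $ j)" for x :: "'a ^ 'n"
  have d_nth: "d x $ j = (if j = i then a * x $ j else x $ j)" for x j
    by (simp add: d_def)
  have lin: "Vector_Spaces.linear (*s) (*s) d"
    by unfold_locales (auto simp: vec_eq_iff d_nth algebra_simps)
  have inj: "inj d"
    using a by (auto simp: inj_def vec_eq_iff d_nth split: if_splits)
  have dist: "hamming_dist (d x) (d y) = hamming_dist x y" for x y
    unfolding hamming_dist_def using a by (intro arg_cong[of _ _ card]) (auto simp: d_nth)
  have "is_code k (d ` C)"
    using vec.linear_subspace_image[OF lin C(1)] vec.dim_image_eq[OF lin, of C] inj C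
    by (auto simp: is_code_def intro: inj_on_subset)
  moreover have "{hamming_dist x y |x y. x \<in> d ` C \<and> y \<in> d ` C \<and> x \<noteq> y} =
      {hamming_dist x y |x y. x \<in> C \<and> y \<in> C \<and> x \<noteq> y}"
    by (auto simp: dist inj_eq[OF inj] image_iff) (metis dist inj inj_eq)+
  ultimately have "is_MDS k (d ` C)"
    using MDS by (simp add: is_MDS_def min_distance_def)
  have form: "(\<Sum>j\<in>UNIV. d y $ j * (d x $ j) ^ q) =
      (\<Sum>j\<in>UNIV. y $ j * (x $ j) ^ q) + (a ^ (q + 1) - 1) * (y $ i * (x $ i) ^ q)" for x y
  proof -
    have "(\<Sum>j\<in>UNIV. d y $ j * (d x $ j) ^ q) =
      (\<Sum>j\<in>UNIV. y $ j * (x $ j) ^ q + (if j = i then (a ^ (q + 1) - 1) * (y $ i * (x $ i) ^ q) else 0))"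
      by (intro sum.cong) (auto simp: d_nth algebra_simps)
    then show ?thesis
      by (simp add: sum.distrib)
  qed
  have "hermitian_hull q (d ` C) = {x \<in> hermitian_hull q C. x $ i = 0}"
  proof (intro equalityI subsetI)
    fix z assume z: "z \<in> hermitian_hull q (d ` C)"
    then obtain x where x: "x \<in> C" "z = d x"
      by (auto simp: hermitian_hull_def)
    have orth: "(\<Sum>j\<in>UNIV. y $ j * (x $ j) ^ q) + (a ^ (q + 1) - 1) * (y $ i * (x $ i) ^ q) = 0"
      if "y \<in> C" for y
      using z that unfolding form[symmetric] x(2) by (auto simp: hermitian_hull_def hermitian_dual_def)
    have "w \<in> C"
      using w by (simp add: hermitian_hull_def)
    \<comment> \<open>Here \<open>w\<close> is the first argument of the form, whereas the dual
      constrains the second; symmetry removes the original form and leaves the added term.\<close>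
    then have "(a ^ (q + 1) - 1) * (w $ i * (x $ i) ^ q) = 0"
      using orth[of w] hermitian_hull_sym[OF q(1,3) w(1) x(1)] by simp
    then have xi: "x $ i = 0"
      using w a by simp
    then have "x \<in> hermitian_hull q C"
      using orth x(1) q(2) by (simp add: hermitian_hull_def hermitian_dual_def power_0_left)
    moreover have "d x = x"
      using xi by (simp add: vec_eq_iff d_nth)
    ultimately show "z \<in> {x \<in> hermitian_hull q C. x $ i = 0}"
      using xi x by simp
  next
    fix x assume x: "x \<in> {x \<in> hermitian_hull q C. x $ i = 0}"
    then have dx: "d x = x"
      by (simp add: vec_eq_iff d_nth)
    have "(\<Sum>j\<in>UNIV. d y $ j * (x $ j) ^ q) = 0" if "y \<in> C" for y
      using x that form[of y x] q(2) unfolding dx by (simp add: hermitian_hull_def hermitian_dual_def)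
    moreover have "x \<in> d ` C"
      using x dx by (auto simp: hermitian_hull_def intro: image_eqI[of _ _ x])
    ultimately show "x \<in> hermitian_hull q (d ` C)"
      by (auto simp: hermitian_hull_def hermitian_dual_def)
  qed
  moreover have "vec.subspace (hermitian_hull q (d ` C))"
    using \<open>is_code k (d ` C)\<close> by (intro subspace_hermitian_hull[OF q(1,3)]) (simp add: is_code_def)
  moreover have "vec.dim (hermitian_hull q C) = Suc (vec.dim {x \<in> hermitian_hull q C. x $ i = 0})"
    using subspace_hermitian_hull[OF q(1,3) C(1)] w by (rule dim_hyperplane_section)
  ultimately have "is_code h (hermitian_hull q (d ` C))"
    using hull by (simp add: is_code_def)
  with \<open>is_MDS k (d ` C)\<close> show ?thesis
    by blast
qed

lemma hermitian_hull_reduce_to: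
  fixes C :: "('a :: {field, finite} ^ 'n) set"
  assumes q: "primepow q" "q > 2" "CARD('a) = q\<^sup>2"
    and "s \<le> l" and "is_MDS k C" and "is_code l (hermitian_hull q C)"
  shows "\<exists>C' :: ('a ^ 'n) set. is_MDS k C' \<and> is_code s (hermitian_hull q C')"
  using assms(4-)
proof (induction s rule: inc_induct)
  case base
  then show ?case by blast
next
  case (step m)
  then show ?case
    using hermitian_hull_reduce[OF q] by blast
qed

section \<open>Counting the exponents without a partner\<close>

text \<open>
  With \<open>k = T * q + r\<close>, encode \<open>i\<close> by \<open>u = i div q\<close> and \<open>v = q - 1 - i mod q\<close>; passing to the partner of
  \<open>i\<close> swaps \<open>u\<close> and \<open>v\<close>.
\<close>

lemma card_unpaired_exponents:
  fixes q T r :: nat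
  assumes "1 \<le> r" and "r \<le> q" and "2 * T + 1 \<le> q"
  defines "k \<equiv> T * q + r"
  shows "card {i. i < k \<and> \<not> (\<exists>j<k. i mod q + j div q = q - 1 \<and> i div q + j mod q = q - 1)} =
         k - (T\<^sup>2 + (if r + T < q then 0 else 2 * (r + T - q) + 1))"
    (is "card ?U = _")
proof -
  let ?N = "{i. i < k \<and> (\<exists>j<k. i mod q + j div q = q - 1 \<and> i div q + j mod q = q - 1)}"
  define f where "f = (\<lambda>(u, v). u * q + (q - 1 - v))"
  \<comment> \<open>Both the exponent and its partner must lie below \<open>k\<close>. Blocks of
    length \<open>q\<close> before block \<open>T\<close> are complete, and block \<open>T\<close>
    has only its first \<open>r\<close> places, whence the two conditions at
    \<open>T\<close>.\<close>
  define S where "S = {(u, v). u \<le> T \<and> v \<le> T \<and> (u = T \<longrightarrow> q \<le> r + v) \<and> (v = T \<longrightarrow> q \<le> r + u)}"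
  have q: "q > 0"
    using assms by simp
  have lt: "u * q + (q - 1 - v) < k \<longleftrightarrow> u \<le> T \<and> (u = T \<longrightarrow> q \<le> r + v)" if "v < q" for u v
  proof -
    consider "u < T" | "u = T" | "u > T" by linarith
    then show ?thesis
    proof cases
      case 1
      then have "Suc u * q \<le> T * q" by (intro mult_le_mono1) simp
      then show ?thesis using 1 q by (simp add: k_def)
    next
      case 2
      then show ?thesis using that assms(1) by (auto simp: k_def)
    next
      case 3
      then have "Suc T * q \<le> u * q" by (intro mult_le_mono1) simp
      then show ?thesis using 3 assms(2) by (simp add: k_def)
    qed
  qed
  have dm: "(u * q + (q - 1 - v)) div q = u" "(u * q + (q - 1 - v)) mod q = q - 1 - v" for u v
    using q by (simp_all add: div_mult_self3 mod_less)
  have "?N = f ` S"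
  proof (intro equalityI subsetI)
    fix i assume "i \<in> ?N"
    then obtain j where ij: "i < k" "j < k" "i mod q + j div q = q - 1" "i div q + j mod q = q - 1"
      by blast
    define u v where "u = i div q" and "v = j div q"
    have uv: "u < q" "v < q"
      using ij q by (auto simp: u_def v_def)
    have mods: "i mod q = q - 1 - v" "j mod q = q - 1 - u"
      using ij(3,4) unfolding u_def v_def by linarith+
    have i: "i = u * q + (q - 1 - v)" and j: "j = v * q + (q - 1 - u)"
      unfolding mods[symmetric] by (simp_all add: u_def v_def)
    have "(u, v) \<in> S"
      using ij(1,2) lt[OF uv(2), of u] lt[OF uv(1), of v] unfolding i[symmetric] j[symmetric]
      by (simp add: S_def)
    then show "i \<in> f ` S"
      using i by (auto simp: f_def intro!: image_eqI[of _ _ "(u, v)"])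
  next
    fix i assume "i \<in> f ` S"
    then obtain u v where uv: "(u, v) \<in> S" "i = u * q + (q - 1 - v)"
      by (auto simp: f_def)
    then have "u < q" "v < q"
      using assms(3) by (auto simp: S_def)
    then show "i \<in> ?N"
      using uv lt[of v u] lt[of u v]
      by (intro CollectI conjI exI[of _ "v * q + (q - 1 - u)"]) (simp_all only: S_def dm, auto)
  qed
  moreover have "inj_on f S"
  proof (rule inj_onI, clarify)
    fix u v u' v' assume "(u, v) \<in> S" "(u', v') \<in> S" and eq: "f (u, v) = f (u', v')"
    then have "v < q" "v' < q"
      using assms(3) by (auto simp: S_def)
    then show "u = u' \<and> v = v'"
      using arg_cong[OF eq, of "\<lambda>x. x div q"] arg_cong[OF eq, of "\<lambda>x. x mod q"]
      unfolding f_def prod.case dm by linarith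
  qed
  moreover have "card S = T\<^sup>2 + (if r + T < q then 0 else 2 * (r + T - q) + 1)"
  proof (cases "r + T < q")
    case True
    then have "S = {..<T} \<times> {..<T}"
      by (auto simp: S_def)
    then show ?thesis
      using True by (simp add: power2_eq_square)
  next
    case False
    define d where "d = q - r"
    have d: "d \<le> T" "q = r + d"
      using False assms by (auto simp: d_def)
    \<comment> \<open>A full square and two arms along \<open>u = T\<close> and
      \<open>v = T\<close>. The corner is put into the first arm only, which gives the odd number
      \<open>2 * (T - d) + 1\<close>.\<close>
    have "S = {..<T} \<times> {..<T} \<union> ({T} \<times> {d..T} \<union> {d..<T} \<times> {T})"
      using d by (auto simp: S_def)
    also have "card \<dots> = card ({..<T} \<times> {..<T}) + card ({T} \<times> {d..T} \<union> {d..<T} \<times> {T})"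
      by (intro card_Un_disjoint) auto
    also have "card ({T} \<times> {d..T} \<union> {d..<T} \<times> {T}) = card ({T} \<times> {d..T}) + card ({d..<T} \<times> {T})"
      by (intro card_Un_disjoint) auto
    finally show ?thesis
      using False d by (simp add: power2_eq_square card_cartesian_product)
  qed
  moreover have "?U = {..<k} - ?N"
    by auto
  moreover have "card ({..<k} - ?N) = k - card ?N"
    by (subst card_Diff_subset) auto
  ultimately show ?thesis
    by (simp only: card_image)
qed


section \<open>Evaluation codes and Reed-Solomon codes\<close>

definition poly_word :: "('n \<Rightarrow> 'a) \<Rightarrow> 'a :: field poly \<Rightarrow> 'a ^ 'n" where
  "poly_word e p = (\<chi> i. poly p (e i))"

lemma poly_word_nth [simp]: "poly_word e p $ i = poly p (e i)"
  by (simp add: poly_word_def)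

lemma linear_poly_word: "poly_word e (p + r) = poly_word e p + poly_word e r"
  "poly_word e (smult c p) = c *s poly_word e p" "poly_word e 0 = 0"
  by (simp_all add: vec_eq_iff)

lemma card_roots_poly_word:
  fixes e :: "'n :: finite \<Rightarrow> 'a :: field"
  assumes "inj e" and "p \<noteq> 0"
  shows "card {i. poly p (e i) = 0} \<le> degree p"
proof -
  have "card {i. poly p (e i) = 0} = card (e ` {i. poly p (e i) = 0})"
    using assms(1) by (metis card_image inj_on_subset subset_UNIV)
  also have "\<dots> \<le> card {x. poly p x = 0}"
    using poly_roots_finite[OF assms(2)] by (intro card_mono) auto
  finally show ?thesis
    using card_poly_roots_bound[OF assms(2)] by linarith
qed

text \<open>A nonzero difference of degree below the length has too few roots to vanish at every
  coordinate.\<close>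

lemma poly_word_eq_iff:
  fixes e :: "'n :: finite \<Rightarrow> 'a :: field"
  assumes "inj e" and "degree p < CARD('n)" and "degree r < CARD('n)"
  shows "poly_word e p = poly_word e r \<longleftrightarrow> p = r"
proof
  assume "poly_word e p = poly_word e r"
  then have "{i. poly (p - r) (e i) = 0} = UNIV"
    by (auto simp: vec_eq_iff)
  moreover have "degree (p - r) < CARD('n)"
    using assms(2,3) by (rule degree_diff_less)
  ultimately show "p = r"
    using card_roots_poly_word[OF assms(1), of "p - r"] by auto
qed simp

text \<open>The monomials with exponents in \<open>A\<close> evaluate to a basis. An arbitrary
  support \<open>A\<close> is allowed so that the result serves both the code and its hull.\<close>

lemma is_code_poly_word:
  fixes e :: "'n :: finite \<Rightarrow> 'a :: field"
  assumes e: "inj e" and A: "A \<subseteq> {..<CARD('n)}"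
  shows "is_code (card A) {poly_word e p | p. \<forall>j. coeff p j \<noteq> 0 \<longrightarrow> j \<in> A}"
    (is "is_code _ ?W")
proof -
  have fin: "finite A"
    using A finite_subset by blast
  have sub: "vec.subspace ?W"
    unfolding vec.subspace_def
  proof (intro conjI ballI allI)
    show "0 \<in> ?W"
      by (auto simp: linear_poly_word intro!: exI[of _ "0 :: 'a poly"])
  next
    fix x y assume "x \<in> ?W" "y \<in> ?W"
    then obtain p r where "x = poly_word e p" "y = poly_word e r"
      "\<And>j. coeff p j \<noteq> 0 \<Longrightarrow> j \<in> A" "\<And>j. coeff r j \<noteq> 0 \<Longrightarrow> j \<in> A"
      by blast
    then show "x + y \<in> ?W"
      by (auto simp: linear_poly_word intro!: exI[of _ "p + r"]) (metis add.right_neutral)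
  next
    fix c and x assume "x \<in> ?W"
    then obtain p where "x = poly_word e p" "\<And>j. coeff p j \<noteq> 0 \<Longrightarrow> j \<in> A"
      by blast
    then show "c *s x \<in> ?W"
      by (auto simp: linear_poly_word intro!: exI[of _ "smult c p"])
  qed
  let ?m = "\<lambda>j. poly_word e (monom 1 j)"
  have deg: "degree (\<Sum>j\<in>A. monom (c j) j) < CARD('n)" for c :: "nat \<Rightarrow> 'a"
    using A by (intro degree_sum_less) (auto intro: le_less_trans[OF degree_monom_le])
  have word: "(\<Sum>j\<in>A. c j *s ?m j) = poly_word e (\<Sum>j\<in>A. monom (c j) j)" for c
    by (simp add: vec_eq_iff poly_sum poly_monom)
  have inj: "inj_on ?m A"
    using A by (intro inj_onI) (subst (asm) poly_word_eq_iff[OF e],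
        auto simp: degree_monom_eq monom_eq_iff')
  have "vec.independent (?m ` A)"
  proof (rule vec.independent_if_scalars_zero)
    fix c x assume "(\<Sum>x\<in>?m ` A. c x *s x) = 0" and x: "x \<in> ?m ` A"
    then have "poly_word e (\<Sum>j\<in>A. monom (c (?m j)) j) = poly_word e 0"
      by (simp add: sum.reindex[OF inj] word linear_poly_word)
    then have 0: "(\<Sum>j\<in>A. monom (c (?m j)) j) = 0"
      using poly_word_eq_iff[OF e deg, of 0] by simp
    obtain j where j: "j \<in> A" "x = ?m j"
      using x by blast
    have "coeff (\<Sum>j\<in>A. monom (c (?m j)) j) j = c (?m j)"
      using j fin by (simp add: coeff_sum)
    then show "c x = 0"
      using 0 j by simp
  qed (use fin in simp)
  moreover have "?m ` A \<subseteq> ?W"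
    by (force split: if_splits)
  moreover have "?W \<subseteq> vec.span (?m ` A)"
  proof
    fix x assume "x \<in> ?W"
    then obtain p where p: "x = poly_word e p" "\<And>j. coeff p j \<noteq> 0 \<Longrightarrow> j \<in> A"
      by blast
    have "p = (\<Sum>j\<in>A. monom (coeff p j) j)"
      using p(2) fin by (auto simp: poly_eq_iff coeff_sum)
    then have "x = (\<Sum>j\<in>A. coeff p j *s ?m j)"
      unfolding word p(1) by simp
    then show "x \<in> vec.span (?m ` A)"
      by (simp add: vec.span_sum vec.span_scale vec.span_base)
  qed
  ultimately have "card (?m ` A) = vec.dim ?W"
    by (intro vec.basis_card_eq_dim)
  then show ?thesis
    using sub by (simp add: is_code_def card_image[OF inj])
qed

definition reed_solomon :: "('n \<Rightarrow> 'a) \<Rightarrow> nat \<Rightarrow> ('a :: field ^ 'n) set" where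
  "reed_solomon e k = {poly_word e p | p. degree p < k}"

text \<open>For \<open>k = 0\<close> the left side is empty, as the zero polynomial has degree 0,
  while the right side contains the zero word.\<close>

lemma reed_solomon_eq:
  fixes e :: "'n :: finite \<Rightarrow> 'a :: field"
  assumes "0 < k"
  shows "reed_solomon e k = {poly_word e p | p. \<forall>j. coeff p j \<noteq> 0 \<longrightarrow> j \<in> {..<k}}"
proof -
  have "degree p < k \<longleftrightarrow> (\<forall>j. coeff p j \<noteq> 0 \<longrightarrow> j \<in> {..<k})" for p :: "'a poly"
    using assms by (metis degree_0 le_degree leading_coeff_0_iff lessThan_iff order_le_less_trans)
  then show ?thesis
    by (simp add: reed_solomon_def)
qed

text \<open>A difference of distinct polynomials of degree below \<open>k\<close> has at most
  \<open>k - 1\<close> roots; a product of \<open>k - 1\<close> linear factors attains this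
  bound.\<close>

lemma is_MDS_reed_solomon:
  fixes e :: "'n :: finite \<Rightarrow> 'a :: {field, finite}"
  assumes e: "inj e" and k: "0 < k" "k \<le> CARD('n)"
  shows "is_MDS k (reed_solomon e k)"
proof -
  let ?D = "{hamming_dist x y | x y. x \<in> reed_solomon e k \<and> y \<in> reed_solomon e k \<and> x \<noteq> y}"
  have dist: "hamming_dist (poly_word e p) (poly_word e r) = CARD('n) - card {i. poly (p - r) (e i) = 0}"
    for p r
  proof -
    have "{i. poly p (e i) \<noteq> poly r (e i)} = UNIV - {i. poly (p - r) (e i) = 0}"
      by auto
    then show ?thesis
      by (simp add: hamming_dist_def card_Diff_subset)
  qed
  have "Min ?D = CARD('n) - k + 1"
  proof (rule Min_eqI)
    have "?D \<subseteq> {..CARD('n)}"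
      by (auto simp: hamming_dist_def intro: card_mono)
    then show "finite ?D"
      using finite_subset by blast
  next
    fix m assume "m \<in> ?D"
    then obtain p r where pr: "degree p < k" "degree r < k" "p \<noteq> r"
      "m = hamming_dist (poly_word e p) (poly_word e r)"
      by (auto simp: reed_solomon_def)
    have "card {i. poly (p - r) (e i) = 0} < k"
      using card_roots_poly_word[OF e, of "p - r"] degree_diff_less[OF pr(1,2)] pr(3) by simp
    then show "CARD('n) - k + 1 \<le> m"
      using k pr(4) dist[of p r] by linarith
  next
    obtain S :: "'n set" where S: "card S = k - 1"
      using k by (metis obtain_subset_with_card_n diff_le_self order_trans)
    define p where "p = (\<Prod>i\<in>S. [:- e i, 1:])"
    have "degree p = k - 1"
      unfolding p_def by (subst degree_prod_eq_sum_degree) (auto simp: S)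
    moreover have roots: "{i. poly p (e i) = 0} = S"
      using e by (auto simp: p_def poly_prod inj_eq)
    moreover have "S \<noteq> UNIV"
      using S k by auto
    then have "poly_word e p \<noteq> poly_word e 0"
      using roots by (auto simp: vec_eq_iff)
    ultimately have "hamming_dist (poly_word e p) (poly_word e 0) \<in> ?D"
      using k unfolding reed_solomon_def
      by (intro CollectI exI conjI refl) (auto intro!: exI[of _ "0 :: 'a poly"])
    moreover have "hamming_dist (poly_word e p) (poly_word e 0) = CARD('n) - k + 1"
      using k by (simp add: dist roots S)
    ultimately show "CARD('n) - k + 1 \<in> ?D"
      by simp
  qed
  moreover have "is_code k (reed_solomon e k)"
    using is_code_poly_word[OF e, of "{..<k}"] k by (simp add: reed_solomon_eq)
  ultimately show ?thesis
    by (simp add: is_MDS_def min_distance_def)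
qed

section \<open>The Hermitian hull of the full-length Reed-Solomon code\<close>

text \<open>As \<open>e\<close> runs through the whole field, the form on words has Gram matrix
  \<open>G\<close> in the monomial basis. For each \<open>j\<close> at most one \<open>i\<close>
  gives a nonzero entry, so testing against monomials isolates single coefficients.\<close>

lemma hermitian_hull_reed_solomon:
  fixes e :: "'n :: finite \<Rightarrow> 'a :: {field, finite}"
  assumes e: "bij e" and q: "primepow q" "2 < q" "CARD('a) = q\<^sup>2"
    and t: "2 * t \<le> q + 1" and k: "0 < k" "k \<le> t * q"
  defines "A \<equiv> {i. i < k \<and> \<not> (\<exists>j<k. i mod q + j div q = q - 1 \<and> i div q + j mod q = q - 1)}"
  shows "hermitian_hull q (reed_solomon e k) = {poly_word e p | p. \<forall>j. coeff p j \<noteq> 0 \<longrightarrow> j \<in> A}"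
proof -
  define P where "P i j \<longleftrightarrow> i mod q + j div q = q - 1 \<and> i div q + j mod q = q - 1" for i j
  define G where "G i j = (\<Sum>a\<in>UNIV. (a::'a) ^ j * (a ^ i) ^ q)" for i j
  have G: "G i j \<noteq> 0 \<longleftrightarrow> P i j" if "i < k" "j < k" for i j
    unfolding G_def P_def using that k by (intro sum_monomials_hermitian[OF q(3,2) t]) auto
  have P_unique: "i = i'" if "P i j" "P i' j" for i i' j
  proof -
    have "i mod q = i' mod q" "i div q = i' div q"
      using that unfolding P_def by linarith+
    then show ?thesis
      by (metis div_mult_mod_eq)
  qed
  have poly_eq: "poly p a = (\<Sum>i<k. coeff p i * a ^ i)" if "degree p < k" for p and a :: 'a
    unfolding poly_altdef using that by (intro sum.mono_neutral_left) (auto intro: coeff_eq_0)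
  have form: "(\<Sum>i\<in>UNIV. poly_word e r $ i * (poly_word e p $ i) ^ q) =
      (\<Sum>j<k. \<Sum>i<k. coeff r j * coeff p i ^ q * G i j)"
    if "degree r < k" "degree p < k" for p r
  proof -
    have "(\<Sum>i\<in>UNIV. poly_word e r $ i * (poly_word e p $ i) ^ q) = (\<Sum>a\<in>UNIV. poly r a * poly p a ^ q)"
      using sum.reindex_bij_betw[OF e, of "\<lambda>a. poly r a * poly p a ^ q"] by simp
    also have "\<dots> = (\<Sum>a\<in>UNIV. \<Sum>j<k. \<Sum>i<k. coeff r j * coeff p i ^ q * (a ^ j * (a ^ i) ^ q))"
      by (simp add: poly_eq that finite_field_power_sum[OF q(1,3)] sum_product power_mult_distrib mult_ac)
    also have "\<dots> = (\<Sum>j<k. \<Sum>i<k. \<Sum>a\<in>UNIV. coeff r j * coeff p i ^ q * (a ^ j * (a ^ i) ^ q))"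
      by (subst sum.swap, intro sum.cong refl, subst sum.swap) simp
    finally show ?thesis
      by (simp add: G_def sum_distrib_left)
  qed
  have supp: "degree p < k" if "\<forall>j. coeff p j \<noteq> 0 \<longrightarrow> j \<in> A" for p :: "'a poly"
    using that k(1) unfolding A_def by (cases "p = 0") auto
  show ?thesis
  proof (intro equalityI subsetI)
    fix x assume x: "x \<in> hermitian_hull q (reed_solomon e k)"
    then obtain p where p: "x = poly_word e p" "degree p < k"
      by (auto simp: hermitian_hull_def reed_solomon_def)
    have "i \<in> A" if i: "coeff p i \<noteq> 0" for i
    proof -
      have ik: "i < k"
        using i p(2) le_degree order_le_less_trans by blast
      \<comment> \<open>Orthogonality to the word of \<open>X ^ j\<close> leaves, by
        \<open>P_unique\<close>, only the term of \<open>i\<close>, which is nonzero.\<close>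
      have False if j: "j < k" "P i j" for j
      proof -
        have dj: "degree (monom (1::'a) j) < k"
          using j by (simp add: degree_monom_eq)
        then have "poly_word e (monom 1 j) \<in> reed_solomon e k"
          by (auto simp: reed_solomon_def)
        then have "0 = (\<Sum>l\<in>UNIV. poly_word e (monom 1 j) $ l * (poly_word e p $ l) ^ q)"
          using x unfolding p(1) hermitian_hull_def hermitian_dual_def by (simp del: poly_word_nth)
        also have "\<dots> = (\<Sum>j'<k. \<Sum>i'<k. if j' = j then coeff p i' ^ q * G i' j else 0)"
          unfolding form[OF dj p(2)] by (intro sum.cong) auto
        also have "\<dots> = (\<Sum>j'<k. if j' = j then (\<Sum>i'<k. coeff p i' ^ q * G i' j) else 0)"
          by (intro sum.cong) auto
        also have "\<dots> = (\<Sum>i'<k. coeff p i' ^ q * G i' j)"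
          using j by simp
        also have "\<dots> = (\<Sum>i'<k. if i' = i then coeff p i ^ q * G i j else 0)"
          using G j P_unique by (intro sum.cong) auto
        also have "\<dots> = coeff p i ^ q * G i j"
          using ik by simp
        finally show False
          using i G[OF ik j(1)] j(2) by simp
      qed
      then show ?thesis
        using ik by (auto simp: A_def P_def)
    qed
    then show "x \<in> {poly_word e p | p. \<forall>j. coeff p j \<noteq> 0 \<longrightarrow> j \<in> A}"
      using p(1) by blast
  next
    fix x assume "x \<in> {poly_word e p | p. \<forall>j. coeff p j \<noteq> 0 \<longrightarrow> j \<in> A}"
    then obtain p where p: "x = poly_word e p" "\<forall>j. coeff p j \<noteq> 0 \<longrightarrow> j \<in> A"
      by blast
    \<comment> \<open>A nonzero \<open>G i j\<close> would give \<open>i\<close> a partner below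
      \<open>k\<close>, contrary to \<open>i\<close> lying in \<open>A\<close>.\<close>
    have "coeff r j * coeff p i ^ q * G i j = 0" if "i < k" "j < k" for r i j
      using that G[OF that] p(2) q(2) unfolding A_def P_def by (cases "coeff p i = 0") auto
    then have "(\<Sum>i\<in>UNIV. poly_word e r $ i * (poly_word e p $ i) ^ q) = 0" if "degree r < k" for r
      unfolding form[OF that supp[OF p(2)]] by (intro sum.neutral ballI) simp
    then show "x \<in> hermitian_hull q (reed_solomon e k)"
      using supp[OF p(2)] unfolding p(1) hermitian_hull_def hermitian_dual_def reed_solomon_def
      by auto
  qed
qed

section \<open>Matching the three parameter ranges with the count\<close>

theorem theorem3:
  fixes q n :: nat and t k l s :: int
  assumes "primepow q" and "q > 2" and "n = q\<^sup>2"
    and "CARD('a :: {field, finite}) = q\<^sup>2" and "CARD('n :: finite) = n"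
    and "1 \<le> t" and "t \<le> \<lceil>real n / (2 * real q)\<rceil>"
    and "((t - 1) * int q + 1 \<le> k \<and> k \<le> t * int q - t \<and> l = k - (t - 1)\<^sup>2) \<or>
         (k = t * int q - t + 1 \<and> l = k - (t - 1)\<^sup>2 - 1) \<or>
         (t * int q - t + 2 \<le> k \<and> k \<le> t * int q \<and> l = 2 * t * int q - t\<^sup>2 - k)"
    and "0 \<le> s" and "s \<le> l"
  shows "\<exists>C :: ('a ^ 'n) set.
           is_MDS (nat k) C \<and> is_code (nat s) (hermitian_hull q C)"
proof -
  define T where "T = nat (t - 1)"
  have t: "t = int T + 1"
    using assms(6) by (simp add: T_def)
  \<comment> \<open>The hypothesis on \<open>t\<close> thus reads
    \<open>t \<le> \<lceil>q / 2\<rceil>\<close>, that is, \<open>2 * t \<le> q + 1\<close>.\<close>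
  have "real n / (2 * real q) = real q / 2"
    using assms(2,3) by (simp add: power2_eq_square)
  then have T: "2 * T + 1 \<le> q"
    using assms(7) unfolding t by linarith
  \<comment> \<open>The remainder runs from 1 to \<open>q\<close>, not from 0 to
    \<open>q - 1\<close>, so that \<open>k = t * q\<close> still belongs to block
    \<open>T\<close>.\<close>
  define r where "r = nat (k - int T * int q)"
  have rb: "1 \<le> k - int T * int q" "k - int T * int q \<le> int q"
    using assms(8) T unfolding t by (auto simp: algebra_simps)
  then have k: "k = int (T * q + r)" and r: "1 \<le> r" "r \<le> q"
    by (simp_all add: r_def nat_le_iff)
  then have nk: "nat k = T * q + r"
    by (simp only: nat_int)
  \<comment> \<open>The three ranges are \<open>r + T < q\<close>, \<open>r + T = q\<close> and
    \<open>r + T > q\<close>; the last two share one formula.\<close>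
  have l: "l = int (T * q + r) - int (T\<^sup>2 + (if r + T < q then 0 else 2 * (r + T - q) + 1))"
  proof (cases "r + T < q")
    case True
    then show ?thesis
      using assms(8) unfolding t k by (auto simp: algebra_simps power2_eq_square)
  next
    case False
    then have "int (r + T - q) = int r + int T - int q"
      by simp
    then show ?thesis
      using False assms(8) unfolding t k by (auto simp: algebra_simps power2_eq_square)
  qed
  define A where
    "A = {i. i < nat k \<and> \<not> (\<exists>j<nat k. i mod q + j div q = q - 1 \<and> i div q + j mod q = q - 1)}"
  \<comment> \<open>The count uses truncated subtraction; \<open>0 \<le> s \<le> l\<close> ensures
    that nothing is cut off.\<close>
  have "int (card A) = l"
    using card_unpaired_exponents[OF r T] assms(9,10) l unfolding A_def nk by linarith
  obtain e :: "'n \<Rightarrow> 'a" where e: "bij e"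
    using assms(3-5) finite_same_card_bij[of "UNIV :: 'n set" "UNIV :: 'a set"] by auto
  have k_le: "nat k \<le> (T + 1) * q"
    using r by (simp add: nk)
  also have "\<dots> \<le> q * q"
    using T assms(2) by (intro mult_le_mono1) linarith
  finally have kn: "nat k \<le> CARD('n)"
    using assms(3,5) by (simp add: power2_eq_square)
  have k0: "0 < nat k"
    using r by (simp add: nk)
  have "hermitian_hull q (reed_solomon e (nat k)) = {poly_word e p | p. \<forall>j. coeff p j \<noteq> 0 \<longrightarrow> j \<in> A}"
    unfolding A_def using T by (intro hermitian_hull_reed_solomon[OF e assms(1,2,4) _ k0 k_le]) simp
  moreover have "A \<subseteq> {..<CARD('n)}"
    using kn by (auto simp: A_def)
  ultimately have "is_code (card A) (hermitian_hull q (reed_solomon e (nat k)))"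
    using is_code_poly_word[OF bij_is_inj[OF e], of A] by simp
  moreover have "is_MDS (nat k) (reed_solomon e (nat k))"
    using bij_is_inj[OF e] k0 kn by (rule is_MDS_reed_solomon)
  moreover have "nat s \<le> card A"
    using \<open>int (card A) = l\<close> assms(9,10) by linarith
  ultimately show ?thesis
    using hermitian_hull_reduce_to[OF assms(1,2,4)] by blast
qed

end
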